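(* For $q\to\infty$ ($q\in\mathbb{N}$) we have $$\dim_H\mathcal{I}_q-\frac12\ \sim\ \frac12\,\frac{\log\log q}{\log q},$$ where $a(q)\sim b(q)$ means $a(q)/b(q)\to1$ as $q\to\infty$.
   Context: Let $\mathbb{I}:=(0,1)\setminus\mathbb{Q}$, and for $x\in\mathbb{I}$ let $(a_i(x))_{i\in\mathbb{N}}$ be the digits of its regular continued fraction expansion $x=1/(a_1(x)+1/(a_2(x)+\cdots))$. For $q\in\mathbb{N}$ let $\mathcal{I}_q:=\{x\in\mathbb{I}:a_i(x)\ge q\text{ for all }i\in\mathbb{N}\}$. $\dim_H$ is Hausdorff dimension. *)

theory Defs
  imports "HOL-Analysis.Analysis" "HOL-Library.Landau_Symbols"
begin

section \<open>Hausdorff measure and dimension\<close>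

text \<open>
  The weight of a covering set is its diameter to the power s, with the usual
  conventions that at \<open>s = 0\<close> every nonempty set has weight 1 and that the empty set
  always has weight 0.  They are spelled out because \<open>0 powr 0 = 0\<close>.
\<close>

definition diam_weight :: "real \<Rightarrow> 'a::metric_space set \<Rightarrow> real" where
  "diam_weight s U = (if U = {} then 0 else if s = 0 then 1 else diameter U powr s)"

text \<open>
  Boundedness of the covering sets is required explicitly: on unbounded sets
  the real-valued \<^const>\<open>diameter\<close> is unspecified.  As the empty set has weight 0,
  covers indexed by \<^typ>\<open>nat\<close> include the finite ones.
\<close>

definition hausdorff_premeasure :: "real \<Rightarrow> real \<Rightarrow> 'a::metric_space set \<Rightarrow> ennreal" where
  "hausdorff_premeasure \<delta> s A =
     (INF U \<in> {U :: nat \<Rightarrow> 'a set. A \<subseteq> (\<Union>i. U i) \<and> (\<forall>i. bounded (U i) \<and> diameter (U i) \<le> \<delta>)}.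
        (\<Sum>i. ennreal (diam_weight s (U i))))"

definition hausdorff_measure :: "real \<Rightarrow> 'a::metric_space set \<Rightarrow> ennreal" where
  "hausdorff_measure s A = (SUP \<delta> \<in> {0<..}. hausdorff_premeasure \<delta> s A)"

definition hausdorff_dim :: "'a::metric_space set \<Rightarrow> ereal" where
  "hausdorff_dim A = Inf (ereal ` {s. 0 \<le> s \<and> hausdorff_measure s A = 0})"


section \<open>Regular continued fractions\<close>

definition unit_irrationals :: "real set" where
  "unit_irrationals = {0<..<1} - \<rat>"

definition gauss_map :: "real \<Rightarrow> real" where
  "gauss_map x = frac (1 / x)"

text \<open>
  Digits are indexed from 0, so \<open>cf_digit x i\<close> is the digit usually written
  \<open>a\<^bsub>i+1\<^esub>(x)\<close>.  The lemma \<open>cf_digit_iff\<close> below shows that, for irrational x in the unit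
  interval, this is the unique sequence of positive integers whose continued fraction
  converges to x.
\<close>

definition cf_digit :: "real \<Rightarrow> nat \<Rightarrow> nat" where
  "cf_digit x i = nat \<lfloor>1 / (gauss_map ^^ i) x\<rfloor>"

definition cf_digits_ge :: "nat \<Rightarrow> real set" where
  "cf_digits_ge q = {x \<in> unit_irrationals. \<forall>i. q \<le> cf_digit x i}"

text \<open>\<open>cf_conv a n = 1/(a 0 + 1/(a 1 + \<dots> + 1/a (n - 1)))\<close>\<close>

fun cf_conv :: "(nat \<Rightarrow> nat) \<Rightarrow> nat \<Rightarrow> real" where
  "cf_conv a 0 = 0"
| "cf_conv a (Suc n) = 1 / (real (a 0) + cf_conv (\<lambda>i. a (Suc i)) n)"

lemma gauss_map_unit_irrationals:
  assumes "x \<in> unit_irrationals"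
  shows "gauss_map x \<in> unit_irrationals"
proof -
  have "1 / x \<notin> \<rat>"
    using assms Rats_divide[of 1 "1 / x"] by (auto simp: unit_irrationals_def)
  then have n: "frac (1 / x) \<notin> \<rat>"
    using Rats_add[of "frac (1/x)" "of_int \<lfloor>1/x\<rfloor>"] by (auto simp: frac_def)
  then have "frac (1 / x) \<noteq> 0"
    by (metis Rats_0)
  then show ?thesis
    using n frac_ge_0[of "1/x"] frac_lt_1[of "1/x"]
    by (auto simp: unit_irrationals_def gauss_map_def less_le)
qed

lemma cf_digit_pos:
  assumes "x \<in> unit_irrationals"
  shows "1 \<le> cf_digit x i"
proof -
  have "(gauss_map ^^ i) x \<in> unit_irrationals"
    by (induction i) (use assms gauss_map_unit_irrationals in auto)
  then have "1 \<le> 1 / (gauss_map ^^ i) x"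
    by (auto simp: unit_irrationals_def)
  then show ?thesis
    unfolding cf_digit_def by linarith
qed

lemma cf_digit_Suc: "cf_digit x (Suc i) = cf_digit (gauss_map x) i"
  by (simp add: cf_digit_def funpow_swap1)

lemma gauss_map_step:
  assumes "x \<in> unit_irrationals"
  shows "x = 1 / (real (cf_digit x 0) + gauss_map x)"
proof -
  have "0 \<le> 1 / x"
    using assms by (auto simp: unit_irrationals_def)
  then have "real (cf_digit x 0) + gauss_map x = 1 / x"
    by (simp add: cf_digit_def gauss_map_def frac_def)
  then show ?thesis by simp
qed

lemma cf_conv_bounds:
  assumes "\<And>i. 1 \<le> a i"
  shows "0 \<le> cf_conv a n \<and> cf_conv a n \<le> 1"
  using assms
proof (induction n arbitrary: a)
  case (Suc n)
  have "0 \<le> cf_conv (\<lambda>i. a (Suc i)) n"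
    using Suc.IH[of "\<lambda>i. a (Suc i)"] Suc.prems by simp
  moreover have "1 \<le> real (a 0)" using Suc.prems[of 0] by simp
  ultimately show ?case by (simp add: divide_simps)
qed simp

lemma cf_conv_error_step:
  assumes "x \<in> unit_irrationals"
  shows "\<bar>cf_conv (cf_digit x) (Suc n) - x\<bar> \<le>
           x * \<bar>cf_conv (cf_digit (gauss_map x)) n - gauss_map x\<bar>"
proof -
  define a t c where "a = real (cf_digit x 0)" and "t = gauss_map x"
    and "c = cf_conv (cf_digit (gauss_map x)) n"
  have a: "1 \<le> a" using cf_digit_pos[OF assms, of 0] by (simp add: a_def)
  have t: "t \<in> unit_irrationals" unfolding t_def by (rule gauss_map_unit_irrationals[OF assms])
  have c: "0 \<le> c"
    using cf_conv_bounds[of "cf_digit t", OF cf_digit_pos[OF t]] by (simp add: c_def t_def)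
  have x: "x = 1 / (a + t)" using gauss_map_step[OF assms] by (simp add: a_def t_def)
  have pos: "0 < a + t" "1 \<le> a + c" using a c t by (auto simp: unit_irrationals_def)
  have "cf_conv (cf_digit x) (Suc n) - x = 1 / (a + c) - 1 / (a + t)"
    using x by (simp add: a_def c_def cf_digit_Suc[abs_def])
  also have "\<dots> = x * (t - c) * (1 / (a + c))"
    using pos by (simp add: x field_simps)
  finally have "\<bar>cf_conv (cf_digit x) (Suc n) - x\<bar> = x * \<bar>c - t\<bar> * (1 / (a + c))"
    using pos x by (simp add: abs_mult abs_minus_commute)
  also have "\<dots> \<le> x * \<bar>c - t\<bar> * 1"
    using pos x by (intro mult_left_mono) auto
  finally show ?thesis by (simp add: c_def t_def)
qed

lemma cf_conv_error:
  assumes "x \<in> unit_irrationals"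
  shows "\<bar>cf_conv (cf_digit x) n - x\<bar> \<le> (1/2) ^ (n div 2)"
  using assms
proof (induction n arbitrary: x rule: induct_nat_012)
  case 0
  then show ?case by (auto simp: unit_irrationals_def)
next
  case 1
  then show ?case
    using cf_conv_bounds[of "cf_digit x" 1, OF cf_digit_pos[OF 1]]
    by (simp add: unit_irrationals_def abs_le_iff del: cf_conv.simps)
next
  case (ge2 n)
  define t where "t = gauss_map x"
  define u where "u = gauss_map t"
  have t: "t \<in> unit_irrationals" and u: "u \<in> unit_irrationals"
    using gauss_map_unit_irrationals ge2.prems by (auto simp: t_def u_def)
  have x0: "0 \<le> x" using ge2.prems by (auto simp: unit_irrationals_def)
  have xt: "x * t \<le> 1/2"
  proof -
    have a: "1 \<le> real (cf_digit x 0)" using cf_digit_pos[OF ge2.prems, of 0] by simp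
    have "x * t = t / (real (cf_digit x 0) + t)"
      using gauss_map_step[OF ge2.prems] by (metis t_def mult.commute mult.right_neutral times_divide_eq_right)
    also have "\<dots> \<le> 1/2" using a t by (auto simp: unit_irrationals_def field_simps)
    finally show ?thesis .
  qed
  have "\<bar>cf_conv (cf_digit x) (Suc (Suc n)) - x\<bar> \<le> x * \<bar>cf_conv (cf_digit t) (Suc n) - t\<bar>"
    unfolding t_def by (rule cf_conv_error_step[OF ge2.prems])
  also have "\<dots> \<le> x * (t * \<bar>cf_conv (cf_digit u) n - u\<bar>)"
    unfolding u_def by (intro mult_left_mono cf_conv_error_step[OF t] x0)
  also have "\<dots> \<le> 1/2 * (1/2) ^ (n div 2)"
    unfolding mult.assoc[symmetric] by (rule mult_mono[OF xt ge2.IH(1)[OF u]]) auto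
  finally show ?case by simp
qed

lemma cf_conv_tendsto:
  assumes "x \<in> unit_irrationals"
  shows "cf_conv (cf_digit x) \<longlonglongrightarrow> x"
proof -
  have "filterlim (\<lambda>n::nat. n div 2) sequentially sequentially"
    unfolding filterlim_at_top eventually_sequentially
    by (metis div_le_mono nonzero_mult_div_cancel_left zero_neq_numeral)
  then have "(\<lambda>n. (1/2 :: real) ^ (n div 2)) \<longlonglongrightarrow> 0"
    by (intro filterlim_compose[OF LIMSEQ_power_zero]) auto
  then have "(\<lambda>n. cf_conv (cf_digit x) n - x) \<longlonglongrightarrow> 0"
    by (rule Lim_null_comparison[rotated]) (use cf_conv_error[OF assms] in auto)
  then show ?thesis by (simp add: LIM_zero_iff)
qed

lemma cf_digit_unique:
  assumes "x \<in> unit_irrationals" "\<And>i. 1 \<le> a i" "cf_conv a \<longlonglongrightarrow> x"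
  shows "a i = cf_digit x i"
  using assms
proof (induction i arbitrary: a x)
  have step: "a 0 = cf_digit x 0 \<and> cf_conv (\<lambda>i. a (Suc i)) \<longlonglongrightarrow> gauss_map x"
    if x: "x \<in> unit_irrationals" and a: "\<And>i. 1 \<le> a i" and l: "cf_conv a \<longlonglongrightarrow> x" for a x
  proof -
    define b where "b = (\<lambda>i. a (Suc i))"
    have b: "0 \<le> cf_conv b n" "cf_conv b n \<le> 1" for n
      using cf_conv_bounds[of b n] a by (auto simp: b_def)
    have x0: "0 < x" using x by (auto simp: unit_irrationals_def)
    have "(\<lambda>n. 1 / cf_conv a (Suc n) - real (a 0)) \<longlonglongrightarrow> 1 / x - real (a 0)"
      using x0 by (intro tendsto_intros LIMSEQ_Suc[OF l]) auto
    then have lb: "cf_conv b \<longlonglongrightarrow> 1 / x - real (a 0)"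
      by (simp add: b_def)
    have y: "0 \<le> 1 / x - real (a 0)" "1 / x - real (a 0) \<le> 1"
      using LIMSEQ_le_const[OF lb, of 0] LIMSEQ_le_const2[OF lb, of 1] b by auto
    have "1 / x \<noteq> real (a 0) + 1"
    proof
      assume "1 / x = real (a 0) + 1"
      then have "x = 1 / (real (a 0) + 1)" using x0 by (metis inverse_eq_divide inverse_inverse_eq)
      moreover have "1 / (real (a 0) + 1) \<in> \<rat>"
        by (intro Rats_divide Rats_add) auto
      ultimately show False using x by (auto simp: unit_irrationals_def)
    qed
    then have fl: "\<lfloor>1 / x\<rfloor> = int (a 0)"
      using y by (intro floor_unique) auto
    then show ?thesis
      using lb by (simp add: cf_digit_def gauss_map_def frac_def b_def)
  qed
  {
    case 0
    then show ?case using step[of x a] by simp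
  next
    case (Suc i)
    have "cf_conv (\<lambda>i. a (Suc i)) \<longlonglongrightarrow> gauss_map x"
      using step[of x a] Suc.prems by simp
    then show ?case
      using Suc.IH[of "gauss_map x" "\<lambda>i. a (Suc i)"] Suc.prems gauss_map_unit_irrationals
      by (simp add: cf_digit_Suc)
  }
qed

lemma cf_digit_iff:
  assumes "x \<in> unit_irrationals"
  shows "(\<forall>i. 1 \<le> a i) \<and> cf_conv a \<longlonglongrightarrow> x \<longleftrightarrow> a = cf_digit x"
  using cf_digit_unique[OF assms] cf_digit_pos[OF assms] cf_conv_tendsto[OF assms] by blast

end

theory Submission
  imports Defs "HOL-Library.Sublist" "HOL-Real_Asymp.Real_Asymp"
begin

text \<open>
  The set \<open>cf_digits_ge q\<close> is the union of its images under the maps \<open>x \<mapsto> 1 / (k + x)\<close> with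
  \<open>k \<ge> q\<close>, and on the unit interval these maps multiply distances by a factor between
  \<open>(k + 1) powr -2\<close> and \<open>k powr -2\<close>.  As in the theory of self-similar sets, the dimension
  \<open>s = 1/2 + e/2\<close> should make the sum of the contraction factors to the power \<open>s\<close> equal to 1.
  That sum is about \<open>(\<Sum>k\<ge>q. k powr (-1 - e))\<close>, hence about \<open>q powr (-e) / e\<close>, so \<open>e\<close> should solve
  \<open>q powr (-e) = e\<close>, whose solution is asymptotic to \<open>ln (ln q) / ln q\<close>.  Replacing \<open>q\<close> by \<open>q - 1\<close>
  or \<open>q + 1\<close> absorbs all the errors, both of the contraction factors and of the comparison of sum
  and integral.

  If \<open>(q - 1) powr (-e) < e\<close>, then replacing each set of a cover by its images under all the maps
  multiplies the total weight by a factor below 1, and repeating this gives Hausdorff measure 0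
  (\<open>hausdorff_measure_zero_if_contracting\<close>).

  If \<open>e < (q + 1) powr (-e)\<close>, then finitely many digits already give a sum of at least 1.
  The numbers with digits from a finite set form a Cantor set with uniformly separated pieces, so
  every covering set is, up to a constant and an arbitrarily small error, no lighter than a single
  cylinder containing all of its points.  Covering by cylinders is a question about words:  words of
  total mass below 1 cannot capture all infinite sequences (\<open>light_words_avoidable\<close>), because a
  sequence avoiding them can be built digit by digit.  This replaces the Bernoulli measure of the
  mass distribution principle and yields \<open>hausdorff_dim_ge_separated_coding\<close>.

  For large \<open>q\<close> the two conditions hold for \<open>e = ln (ln (q - 1)) / ln (q - 1)\<close> and, with
  \<open>l = ln (ln (q + 1))\<close>, for \<open>e = (l - ln l) / ln (q + 1)\<close>.
\<close>

section \<open>Hausdorff dimension\<close>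

lemma hausdorff_premeasure_le_cover:
  assumes "A \<subseteq> (\<Union>i. U i)" "\<And>i. bounded (U i)" "\<And>i. diameter (U i) \<le> \<delta>"
  shows "hausdorff_premeasure \<delta> s A \<le> (\<Sum>i. ennreal (diam_weight s (U i)))"
  unfolding hausdorff_premeasure_def using assms by (intro INF_lower) auto

lemma diam_weight_nonneg: "0 \<le> diam_weight s U"
  by (simp add: diam_weight_def)

lemma diam_weight_antimono:
  assumes "bounded U" "diameter U \<le> 1" "0 \<le> t" "t \<le> s"
  shows "diam_weight s U \<le> diam_weight t U"
  using assms diameter_ge_0[of U] powr_mono'[of t s "diameter U"] powr_mono'[of 0 s "diameter U"]
  by (auto simp: diam_weight_def split: if_splits)

text \<open>
  The scale is 1 because diameters at most 1 are what makes the weight decrease with the exponent.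
\<close>

lemma hausdorff_premeasure_antimono:
  assumes "0 \<le> t" "t \<le> s"
  shows "hausdorff_premeasure 1 s A \<le> hausdorff_premeasure 1 t A"
  unfolding hausdorff_premeasure_def
proof (rule INF_mono)
  fix U :: "nat \<Rightarrow> 'a set"
  assume U: "U \<in> {U. A \<subseteq> (\<Union>i. U i) \<and> (\<forall>i. bounded (U i) \<and> diameter (U i) \<le> 1)}"
  then have "(\<Sum>i. ennreal (diam_weight s (U i))) \<le> (\<Sum>i. ennreal (diam_weight t (U i)))"
    by (intro suminf_le ennreal_leI diam_weight_antimono assms) auto
  with U show "\<exists>V\<in>{U. A \<subseteq> (\<Union>i. U i) \<and> (\<forall>i. bounded (U i) \<and> diameter (U i) \<le> 1)}.
      (\<Sum>i. ennreal (diam_weight s (V i))) \<le> (\<Sum>i. ennreal (diam_weight t (U i)))"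
    by blast
qed

text \<open>
  For the dimension it suffices to look at one scale:  if the measure vanished for some
  exponent \<open>t < s\<close>, so would the premeasure at scale 1, first for \<open>t\<close> and then for \<open>s\<close>.
\<close>

lemma hausdorff_dim_ge_premeasure:
  assumes "0 < hausdorff_premeasure 1 s A"
  shows "ereal s \<le> hausdorff_dim A"
  unfolding hausdorff_dim_def
proof (rule Inf_greatest)
  fix e assume "e \<in> ereal ` {s. 0 \<le> s \<and> hausdorff_measure s A = 0}"
  then obtain t where e: "e = ereal t" and t: "0 \<le> t" "hausdorff_measure t A = 0"
    by auto
  have "hausdorff_premeasure 1 t A \<le> hausdorff_measure t A"
    unfolding hausdorff_measure_def by (rule SUP_upper) auto
  with t have "hausdorff_premeasure 1 t A = 0" by simp
  then have "\<not> t \<le> s"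
    using assms hausdorff_premeasure_antimono[OF t(1), of s A] by auto
  then show "ereal s \<le> e" using e by simp
qed

lemma hausdorff_dim_le:
  assumes "0 \<le> s" "hausdorff_measure s A = 0"
  shows "hausdorff_dim A \<le> ereal s"
  unfolding hausdorff_dim_def using assms by (intro Inf_lower) auto

lemma diameter_image_le:
  assumes "bounded U" "0 \<le> L" "\<And>x y. x \<in> U \<Longrightarrow> y \<in> U \<Longrightarrow> dist (f x) (f y) \<le> L * dist x y"
  shows "diameter (f ` U) \<le> L * diameter U"
proof (cases "U = {}")
  case False
  have "dist (f x) (f y) \<le> L * diameter U" if "x \<in> U" "y \<in> U" for x y
    using assms(3)[OF that] mult_left_mono[OF diameter_bounded_bound[OF assms(1) that] assms(2)]
    by linarith
  then show ?thesis
    using False by (auto simp: diameter_def[of "f ` U"] intro!: cSUP_least)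
qed simp

lemma bounded_image_lipschitz:
  assumes "bounded U" "0 \<le> L" "\<And>x y. x \<in> U \<Longrightarrow> y \<in> U \<Longrightarrow> dist (f x) (f y) \<le> L * dist x y"
  shows "bounded (f ` U)"
  unfolding bounded_two_points
proof (intro exI ballI)
  fix u v assume "u \<in> f ` U" "v \<in> f ` U"
  then obtain x y where xy: "x \<in> U" "y \<in> U" "u = f x" "v = f y" by auto
  show "dist u v \<le> L * diameter U"
    using assms(3)[OF xy(1,2)] mult_left_mono[OF diameter_bounded_bound[OF assms(1) xy(1,2)] assms(2)]
    unfolding xy by linarith
qed

text \<open>
  From a cover \<open>U\<close> of \<open>A\<close> one gets the cover of \<open>A\<close> by all \<open>f k ` U i\<close>.  This
  multiplies the total weight by at most \<open>\<Sum>k. L k powr s\<close> and the diameters by at most \<open>\<rho>\<close>.  Starting from \<open>A\<close>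
  itself and iterating, both tend to 0.
\<close>

lemma hausdorff_measure_zero_if_contracting:
  fixes A :: "'a::metric_space set" and f :: "nat \<Rightarrow> 'a \<Rightarrow> 'a"
  assumes A: "bounded A" "A \<subseteq> (\<Union>k. f k ` A)"
    and lip: "\<And>k x y. x \<in> A \<Longrightarrow> y \<in> A \<Longrightarrow> dist (f k x) (f k y) \<le> L k * dist x y"
    and L: "\<And>k. 0 \<le> L k" "\<And>k. L k \<le> \<rho>" "\<rho> < 1"
    and s: "0 < s" and Z: "(\<Sum>k. ennreal (L k powr s)) < 1"
  shows "hausdorff_measure s A = 0"
proof -
  define Z where "Z = (\<Sum>k. ennreal (L k powr s))"
  define W where "W = ennreal (diam_weight s A)"
  have \<rho>0: "0 \<le> \<rho>" using L(1,2)[of 0] by simp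
  have cover: "\<exists>U. (\<forall>i::nat. U i \<subseteq> A \<and> diameter (U i) \<le> \<rho> ^ n * diameter A) \<and>
      A \<subseteq> (\<Union>i. U i) \<and> (\<Sum>i. ennreal (diam_weight s (U i))) \<le> Z ^ n * W" for n
  proof (induction n)
    case 0
    define U where "U = (\<lambda>i::nat. if i = 0 then A else {})"
    have "(\<Sum>i. ennreal (diam_weight s (U i))) = (\<Sum>i\<in>{0}. ennreal (diam_weight s (U i)))"
      by (rule suminf_finite) (auto simp: U_def diam_weight_def)
    then have "(\<Sum>i. ennreal (diam_weight s (U i))) \<le> Z ^ 0 * W"
      by (simp add: U_def W_def)
    moreover have "(\<Union>i. U i) = A" by (auto simp: U_def)
    ultimately show ?case
      using A by (intro exI[of _ U]) (auto simp: U_def diameter_ge_0)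
  next
    case (Suc n)
    then obtain U where U: "\<And>i::nat. U i \<subseteq> A" "\<And>i. diameter (U i) \<le> \<rho> ^ n * diameter A"
      "A \<subseteq> (\<Union>i. U i)" "(\<Sum>i. ennreal (diam_weight s (U i))) \<le> Z ^ n * W"
      by blast
    have bU: "bounded (U i)" for i using U(1) A(1) bounded_subset by blast
    \<comment> \<open>Intersecting with \<open>A\<close> keeps the cover inside the set on which the maps are contractions.\<close>
    define V where "V = (\<lambda>j. f (fst (prod_decode j)) ` U (snd (prod_decode j)) \<inter> A)"
    have lipU: "dist (f k x) (f k y) \<le> L k * dist x y" if "x \<in> U i" "y \<in> U i" for k i x y
      using lip U(1) that by blast
    have diamV: "diameter (V j) \<le> L (fst (prod_decode j)) * diameter (U (snd (prod_decode j)))" for j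
      using diameter_image_le[OF bU L(1) lipU] bounded_image_lipschitz[OF bU L(1) lipU]
      unfolding V_def by (meson diameter_subset inf_le1 order_trans)
    have "diam_weight s (V j) \<le>
        L (fst (prod_decode j)) powr s * diam_weight s (U (snd (prod_decode j)))" for j
    proof (cases "V j = {}")
      case True
      then show ?thesis by (simp add: diam_weight_def)
    next
      case False
      then have "U (snd (prod_decode j)) \<noteq> {}" by (auto simp: V_def)
      moreover have "bounded (V j)" using A(1) by (auto simp: V_def)
      ultimately show ?thesis
        using False s powr_mono2[OF _ diameter_ge_0 diamV[of j], of s] L(1) diameter_ge_0[OF bU]
        by (simp add: diam_weight_def powr_mult)
    qed
    then have "(\<Sum>j. ennreal (diam_weight s (V j))) \<le>
        (\<Sum>j. (\<lambda>(k,i). ennreal (L k powr s) * ennreal (diam_weight s (U i))) (prod_decode j))"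
      by (intro suminf_le)
         (auto simp: ennreal_mult[symmetric] diam_weight_nonneg split_beta intro!: ennreal_leI)
    also have "\<dots> = (\<Sum>k. ennreal (L k powr s) * (\<Sum>i. ennreal (diam_weight s (U i))))"
      by (rule suminf_ennreal_2dimen) simp
    also have "\<dots> = Z * (\<Sum>i. ennreal (diam_weight s (U i)))"
      by (simp add: Z_def)
    also have "\<dots> \<le> Z * (Z ^ n * W)" by (intro mult_left_mono U(4)) simp
    finally have sumV: "(\<Sum>j. ennreal (diam_weight s (V j))) \<le> Z ^ Suc n * W"
      by (simp add: mult.assoc)
    have "diameter (V j) \<le> \<rho> * (\<rho> ^ n * diameter A)" for j
      using diamV[of j] mult_mono[OF L(2) U(2) \<rho>0 diameter_ge_0[OF bU]]
      by (meson order_trans)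
    moreover have "A \<subseteq> (\<Union>j. V j)"
    proof
      fix x assume x: "x \<in> A"
      then obtain k y where y: "y \<in> A" "x = f k y" using A(2) by blast
      then obtain i where "y \<in> U i" using U(3) by blast
      then have "x \<in> V (prod_encode (k, i))" using x y by (auto simp: V_def)
      then show "x \<in> (\<Union>j. V j)" by blast
    qed
    ultimately show ?case
      using sumV by (intro exI[of _ V]) (auto simp: V_def mult.assoc)
  qed
  have "hausdorff_premeasure \<delta> s A = 0" if \<delta>: "0 < \<delta>" for \<delta>
  proof -
    obtain z where z: "Z = ennreal z" "0 \<le> z" "z < 1"
      using Z unfolding Z_def[symmetric] by (cases Z) (auto simp: ennreal_less_one_iff)
    define w where "w = diam_weight s A"
    have "(\<lambda>n. \<rho> ^ n * diameter A) \<longlonglongrightarrow> 0"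
      using \<rho>0 L(3) by (auto intro!: tendsto_eq_intros LIMSEQ_power_zero)
    then have ev: "\<forall>\<^sub>F n in sequentially. \<rho> ^ n * diameter A < \<delta>"
      using \<delta> by (rule order_tendstoD(2))
    have "\<forall>\<^sub>F n in sequentially. hausdorff_premeasure \<delta> s A \<le> ennreal (z ^ n * w)"
      using ev
    proof eventually_elim
      case (elim n)
      obtain U where U: "\<And>i::nat. U i \<subseteq> A" "\<And>i. diameter (U i) \<le> \<rho> ^ n * diameter A"
          "A \<subseteq> (\<Union>i. U i)" "(\<Sum>i. ennreal (diam_weight s (U i))) \<le> Z ^ n * W"
        using cover[of n] by blast
      have "hausdorff_premeasure \<delta> s A \<le> (\<Sum>i. ennreal (diam_weight s (U i)))"
        using U(3) bounded_subset[OF A(1) U(1)] order_trans[OF U(2) less_imp_le[OF elim]]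
        by (rule hausdorff_premeasure_le_cover)
      also have "\<dots> \<le> ennreal (z ^ n * w)"
        using U(4) z by (simp add: W_def w_def ennreal_mult diam_weight_nonneg ennreal_power)
      finally show ?case .
    qed
    moreover have "(\<lambda>n. ennreal (z ^ n * w)) \<longlonglongrightarrow> ennreal 0"
      using z by (intro tendsto_ennrealI) (auto intro!: tendsto_eq_intros LIMSEQ_power_zero)
    ultimately have "hausdorff_premeasure \<delta> s A \<le> ennreal 0"
      by (intro tendsto_lowerbound) auto
    then show ?thesis by simp
  qed
  then show ?thesis by (simp add: hausdorff_measure_def)
qed

section \<open>Codings by sequences over a finite alphabet\<close>

text \<open>
  Call a word \<open>v\<close> good if the given words extending \<open>v\<close> have total mass less than the mass of
  \<open>v\<close>.  The empty word is good, and a good word has a good extension by one letter, since the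
  masses of its extensions add up to at least its own.  A given word is never good, as it extends
  itself, so an infinite sequence all of whose prefixes are good is captured by none of them.
\<close>

lemma light_words_avoidable:
  fixes p :: "'d \<Rightarrow> ennreal" and w :: "nat \<Rightarrow> 'd list"
  assumes D: "finite D" "1 \<le> (\<Sum>a\<in>D. p a)" and light: "(\<Sum>i. prod_list (map p (w i))) < 1"
  obtains x where "range x \<subseteq> D" "\<And>i. map x [0..<length (w i)] \<noteq> w i"
proof -
  define p' where "p' v = prod_list (map p v)" for v
  define S where "S v = (\<Sum>i. if prefix v (w i) then p' (w i) else 0)" for v
  define P where "P n v \<longleftrightarrow> length v = n \<and> set v \<subseteq> D \<and> S v < p' v" for n v
  have step: "\<exists>u. P (Suc n) u \<and> (\<exists>a. u = v @ [a])" if P: "P n v" for n v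
  proof -
    have "(\<Sum>a\<in>D. S (v @ [a])) = (\<Sum>i. \<Sum>a\<in>D. if prefix (v @ [a]) (w i) then p' (w i) else 0)"
      unfolding S_def by (rule suminf_sum[symmetric]) simp
    also have "\<dots> \<le> S v"
      unfolding S_def
    proof (intro suminf_le allI)
      fix i
      show "(\<Sum>a\<in>D. if prefix (v @ [a]) (w i) then p' (w i) else 0) \<le>
          (if prefix v (w i) then p' (w i) else 0)"
      proof (cases "\<exists>c. prefix (v @ [c]) (w i)")
        case True
        then obtain c where c: "prefix (v @ [c]) (w i)" by blast
        then have "prefix (v @ [a]) (w i) \<longleftrightarrow> a = c" for a
          by (auto simp: prefix_def)
        moreover have "prefix v (w i)" using c by (auto simp: prefix_def)
        ultimately show ?thesis using D by simp
      qed simp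
    qed simp_all
    finally have "(\<Sum>a\<in>D. S (v @ [a])) \<le> S v" .
    also have "S v < p' v" using P by (simp add: P_def)
    also have "p' v \<le> p' v * (\<Sum>a\<in>D. p a)" using mult_left_mono[OF D(2), of "p' v"] by simp
    also have "\<dots> = (\<Sum>a\<in>D. p' (v @ [a]))" by (simp add: p'_def sum_distrib_left)
    finally have "\<exists>a\<in>D. S (v @ [a]) < p' (v @ [a])"
      by (meson leD not_le_imp_less sum_mono)
    then obtain a where "a \<in> D" "S (v @ [a]) < p' (v @ [a])" by blast
    then have "P (Suc n) (v @ [a])" using P by (simp add: P_def)
    then show ?thesis by blast
  qed
  have "P 0 []" using light by (simp add: P_def S_def p'_def)
  then obtain f where f: "\<And>n. P n (f n)" "\<And>n. \<exists>a. f (Suc n) = f n @ [a]"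
    using dependent_nat_choice[of P "\<lambda>_ v u. \<exists>a. u = v @ [a]"] step by blast
  define x where "x n = last (f (Suc n))" for n
  have fx: "f n = map x [0..<n]" for n
  proof (induction n)
    case 0
    then show ?case using f(1)[of 0] by (simp add: P_def)
  next
    case (Suc n)
    then show ?case using f(2)[of n] by (auto simp: x_def)
  qed
  show ?thesis
  proof
    show "range x \<subseteq> D"
    proof
      fix a assume "a \<in> range x"
      then obtain n where "a = x n" by blast
      then show "a \<in> D" using f(1)[of "Suc n"] fx[of "Suc n"] by (auto simp: P_def)
    qed
    show "map x [0..<length (w i)] \<noteq> w i" for i
    proof
      assume "map x [0..<length (w i)] = w i"
      then have "S (w i) < p' (w i)" using f(1)[of "length (w i)"] fx by (simp add: P_def)
      moreover have "p' (w i) \<le> S (w i)"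
        using sum_le_suminf[of "\<lambda>j. if prefix (w i) (w j) then p' (w j) else 0" "{i}"]
        by (simp add: S_def)
      ultimately show False by simp
    qed
  qed
qed

lemma prod_list_map_upt: "prod_list (map g (map x [0..<n])) = (\<Prod>i<n. g (x i))"
  for g :: "'d \<Rightarrow> 'a::comm_monoid_mult"
  by (induction n) (simp_all add: mult.commute)

lemma ennreal_prod_list_map:
  assumes "\<And>a. 0 \<le> g a"
  shows "prod_list (map (\<lambda>a. ennreal (g a)) v) = ennreal (prod_list (map g v))"
  using assms by (induction v) (simp_all add: ennreal_mult')

text \<open>
  Let \<open>v\<close> be the longest common prefix of all codes of points in a set \<open>U\<close>, if there are at
  least two such codes.  Two of them differ right after \<open>v\<close>, so by separation the diameter of \<open>U\<close> is at least \<open>\<kappa>\<close>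
  times the product of the ratios along \<open>v\<close>, and the weight of \<open>U\<close> dominates the mass of \<open>v\<close>, where a
  letter \<open>a\<close> has mass \<open>r a powr s\<close>.  A very light cover of \<open>A\<close> would thus yield words of total mass
  below 1 which capture all codes.
\<close>

lemma hausdorff_dim_ge_separated_coding:
  fixes \<pi> :: "(nat \<Rightarrow> 'd) \<Rightarrow> 'a::metric_space" and r :: "'d \<Rightarrow> real"
  assumes D: "finite D" and s: "0 < s" and \<kappa>: "0 < \<kappa>"
    and r: "\<And>a. a \<in> D \<Longrightarrow> 0 < r a" "\<And>a. a \<in> D \<Longrightarrow> r a < 1"
    and sum: "1 \<le> (\<Sum>a\<in>D. r a powr s)"
    and sep: "\<And>x y n. range x \<subseteq> D \<Longrightarrow> range y \<subseteq> D \<Longrightarrow> (\<And>i. i < n \<Longrightarrow> x i = y i) \<Longrightarrow> x n \<noteq> y n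
      \<Longrightarrow> \<kappa> * (\<Prod>i<n. r (x i)) \<le> dist (\<pi> x) (\<pi> y)"
    and code: "\<And>x. range x \<subseteq> D \<Longrightarrow> \<pi> x \<in> A"
  shows "ereal s \<le> hausdorff_dim A"
proof (rule hausdorff_dim_ge_premeasure)
  define g where "g a = r a powr s" for a
  have gp: "prod_list (map g (map x [0..<n])) = (\<Prod>i<n. r (x i)) powr s" if "range x \<subseteq> D" for x n
  proof -
    have "prod_list (map g (map x [0..<n])) = (\<Prod>i<n. g (x i))"
      by (rule prod_list_map_upt)
    also have "\<dots> = (\<Prod>i<n. r (x i)) powr s"
      unfolding g_def by (rule prod_powr_distrib[symmetric])
    finally show ?thesis .
  qed
  \<comment> \<open>The summand \<open>\<eta>\<close> is for sets with at most one code:  these may have weight 0, while every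
    word has positive mass.\<close>
  have word: "\<exists>v. set v \<subseteq> D \<and> (\<forall>x. range x \<subseteq> D \<and> \<pi> x \<in> U \<longrightarrow> map x [0..<length v] = v) \<and>
      prod_list (map g v) \<le> 1 / \<kappa> powr s * diam_weight s U + \<eta>"
    if U: "bounded U" and \<eta>: "0 < \<eta>" for U \<eta>
  proof (cases "\<exists>n x y. range x \<subseteq> D \<and> \<pi> x \<in> U \<and> range y \<subseteq> D \<and> \<pi> y \<in> U \<and> x n \<noteq> y n")
    case True
    define Q where "Q n \<longleftrightarrow> (\<exists>x y. range x \<subseteq> D \<and> \<pi> x \<in> U \<and> range y \<subseteq> D \<and> \<pi> y \<in> U \<and> x n \<noteq> y n)" for n
    define n where "n = (LEAST n. Q n)"
    have "\<exists>n. Q n" using True by (simp add: Q_def)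
    then have "Q n" unfolding n_def by (rule LeastI_ex[of Q])
    then obtain x y where x: "range x \<subseteq> D" "\<pi> x \<in> U" and y: "range y \<subseteq> D" "\<pi> y \<in> U" and "x n \<noteq> y n"
      unfolding Q_def by blast
    have agree: "x i = z i" if "i < n" "range z \<subseteq> D" "\<pi> z \<in> U" for i z
    proof -
      have "\<not> Q i" using not_less_Least[of i Q] that(1) by (simp add: n_def)
      then show ?thesis using that(2,3) x unfolding Q_def by blast
    qed
    have "\<kappa> * (\<Prod>i<n. r (x i)) \<le> dist (\<pi> x) (\<pi> y)"
      by (rule sep[OF x(1) y(1) _ \<open>x n \<noteq> y n\<close>]) (rule agree[OF _ y])
    also have "\<dots> \<le> diameter U" by (rule diameter_bounded_bound[OF U x(2) y(2)])
    finally have "(\<Prod>i<n. r (x i)) \<le> diameter U / \<kappa>" using \<kappa> by (simp add: field_simps)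
    moreover have "0 \<le> (\<Prod>i<n. r (x i))"
      using x(1) r(1) by (intro prod_nonneg) (meson less_imp_le range_subsetD)
    ultimately have "(\<Prod>i<n. r (x i)) powr s \<le> (diameter U / \<kappa>) powr s"
      using s by (intro powr_mono2) auto
    also have "\<dots> = 1 / \<kappa> powr s * diam_weight s U"
      using x(2) s \<kappa> diameter_ge_0[OF U] by (auto simp: diam_weight_def powr_divide)
    finally have "prod_list (map g (map x [0..<n])) \<le> 1 / \<kappa> powr s * diam_weight s U + \<eta>"
      using \<eta> unfolding gp[OF x(1)] by simp
    moreover have "map z [0..<n] = map x [0..<n]" if "range z \<subseteq> D" "\<pi> z \<in> U" for z
      using agree[OF _ that] by (auto intro: sym)
    moreover have "set (map x [0..<n]) \<subseteq> D" using x(1) by auto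
    ultimately show ?thesis
      by (intro exI[of _ "map x [0..<n]"]) (simp del: map_eq_conv)
  next
    case False
    have "D \<noteq> {}" using sum by auto
    then obtain c where c: "c \<in> D" by blast
    obtain z where z: "range z \<subseteq> D" "\<And>x. range x \<subseteq> D \<Longrightarrow> \<pi> x \<in> U \<Longrightarrow> x = z"
    proof (cases "\<exists>x. range x \<subseteq> D \<and> \<pi> x \<in> U")
      case True
      then show ?thesis using that False by blast
    next
      case False
      then show ?thesis using that[of "\<lambda>_. c"] c by blast
    qed
    define \<rho> where "\<rho> = Max (g ` D)"
    have "\<rho> \<in> g ` D" unfolding \<rho>_def using D c by (intro Max_in) auto
    then have \<rho>: "0 \<le> \<rho>" "\<rho> < 1"
      using r s powr_less_mono2[of s _ 1] by (auto simp: g_def less_imp_le)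
    have "g a \<le> \<rho>" if "a \<in> D" for a unfolding \<rho>_def using D that by auto
    obtain n where n: "\<rho> ^ n < \<eta>" using real_arch_pow_inv[OF \<eta> \<rho>(2)] by blast
    have "prod_list (map g (map z [0..<n])) = (\<Prod>i<n. g (z i))"
      by (rule prod_list_map_upt)
    also have "\<dots> \<le> (\<Prod>i<n. \<rho>)"
      using z(1) \<open>\<And>a. a \<in> D \<Longrightarrow> g a \<le> \<rho>\<close> by (intro prod_mono) (auto simp: g_def)
    also have "\<dots> \<le> 1 / \<kappa> powr s * diam_weight s U + \<eta>"
      using n diam_weight_nonneg[of s U] by (simp add: add_increasing)
    finally have "prod_list (map g (map z [0..<n])) \<le> 1 / \<kappa> powr s * diam_weight s U + \<eta>" .
    moreover have "map x [0..<n] = map z [0..<n]" if "range x \<subseteq> D" "\<pi> x \<in> U" for x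
      unfolding z(2)[OF that] ..
    moreover have "set (map z [0..<n]) \<subseteq> D" using z(1) by auto
    ultimately show ?thesis
      by (intro exI[of _ "map z [0..<n]"]) (simp del: map_eq_conv)
  qed
  have "ennreal (\<kappa> powr s / 2) \<le> hausdorff_premeasure 1 s A"
  proof (rule ccontr)
    assume "\<not> ?thesis"
    then obtain U :: "nat \<Rightarrow> 'a set" where U: "A \<subseteq> (\<Union>i. U i)" "\<And>i. bounded (U i)"
      and small: "(\<Sum>i. ennreal (diam_weight s (U i))) < ennreal (\<kappa> powr s / 2)"
      unfolding hausdorff_premeasure_def not_le INF_less_iff by blast
    have "\<forall>i. \<exists>v. set v \<subseteq> D \<and> (\<forall>x. range x \<subseteq> D \<and> \<pi> x \<in> U i \<longrightarrow> map x [0..<length v] = v) \<and>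
      prod_list (map g v) \<le> 1 / \<kappa> powr s * diam_weight s (U i) + (1/2) ^ Suc (Suc i)"
      by (intro allI word U(2)) simp
    then obtain w where w: "\<And>i. set (w i) \<subseteq> D"
      "\<And>i x. range x \<subseteq> D \<Longrightarrow> \<pi> x \<in> U i \<Longrightarrow> map x [0..<length (w i)] = w i"
      "\<And>i. prod_list (map g (w i)) \<le> 1 / \<kappa> powr s * diam_weight s (U i) + (1/2) ^ Suc (Suc i)"
      by metis
    have nonneg: "0 \<le> 1 / \<kappa> powr s" "0 \<le> 1 / \<kappa> powr s * diam_weight s V" "0 \<le> (1/2 :: real) ^ n"
        "0 \<le> \<kappa> powr s / 2" "0 \<le> 1 / \<kappa> powr s * (\<kappa> powr s / 2)" "0 \<le> (1/2 :: real)"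
      for V :: "'a set" and n
      using diam_weight_nonneg[of s V] by auto
    have half: "(\<Sum>i. ennreal ((1/2) ^ Suc (Suc i))) = ennreal (1/2)"
      using sums_mult[OF power_half_series, of "1/2"] by (intro suminf_ennreal_eq) auto
    have "(\<Sum>i. prod_list (map (\<lambda>a. ennreal (g a)) (w i))) \<le>
        (\<Sum>i. ennreal (1 / \<kappa> powr s) * ennreal (diam_weight s (U i)) + ennreal ((1/2) ^ Suc (Suc i)))"
    proof (intro suminf_le allI)
      fix i
      have "prod_list (map (\<lambda>a. ennreal (g a)) (w i)) = ennreal (prod_list (map g (w i)))"
        by (rule ennreal_prod_list_map) (simp add: g_def)
      also have "\<dots> \<le> ennreal (1 / \<kappa> powr s * diam_weight s (U i) + (1/2) ^ Suc (Suc i))"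
        by (intro ennreal_leI w)
      finally show "prod_list (map (\<lambda>a. ennreal (g a)) (w i)) \<le>
          ennreal (1 / \<kappa> powr s) * ennreal (diam_weight s (U i)) + ennreal ((1/2) ^ Suc (Suc i))"
        by (simp only: ennreal_mult[symmetric] ennreal_plus[symmetric] diam_weight_nonneg nonneg)
    qed simp_all
    also have "\<dots> = ennreal (1 / \<kappa> powr s) * (\<Sum>i. ennreal (diam_weight s (U i))) + ennreal (1/2)"
      by (subst suminf_add[symmetric]) (simp_all only: summableI half ennreal_suminf_cmult)
    also have "\<dots> < ennreal (1 / \<kappa> powr s) * ennreal (\<kappa> powr s / 2) + ennreal (1/2)"
      using ennreal_mult_strict_left_mono[OF small, of "ennreal (1 / \<kappa> powr s)"] \<kappa>
      unfolding add.commute[of _ "ennreal (1/2)"] ennreal_add_left_cancel_less by simp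
    also have "\<dots> = ennreal (1 / \<kappa> powr s * (\<kappa> powr s / 2) + 1/2)"
      by (simp only: ennreal_mult[symmetric] ennreal_plus[symmetric] nonneg)
    also have "1 / \<kappa> powr s * (\<kappa> powr s / 2) + 1/2 = 1" using \<kappa> by simp
    also have "ennreal 1 = 1" by simp
    finally have light: "(\<Sum>i. prod_list (map (\<lambda>a. ennreal (g a)) (w i))) < 1" .
    have heavy: "1 \<le> (\<Sum>a\<in>D. ennreal (g a))"
      using sum ennreal_leI[OF sum] by (simp add: g_def sum_ennreal)
    from light_words_avoidable[OF D heavy light]
    obtain x where x: "range x \<subseteq> D" "\<And>i. map x [0..<length (w i)] \<noteq> w i" by blast
    obtain i where "\<pi> x \<in> U i" using code[OF x(1)] U(1) by blast
    then show False using w(2) x by blast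
  qed
  moreover have "0 < ennreal (\<kappa> powr s / 2)" using \<kappa> by simp
  ultimately show "0 < hausdorff_premeasure 1 s A" by (rule order_less_le_trans[rotated])
qed

section \<open>Numbers with prescribed continued fraction digits\<close>

lemma inverse_shift_diff:
  fixes a b u v :: real
  assumes "0 < a + u" "0 < b + v"
  shows "\<bar>1 / (a + u) - 1 / (b + v)\<bar> = \<bar>(a + u) - (b + v)\<bar> / ((a + u) * (b + v))"
proof -
  have "1 / (a + u) - 1 / (b + v) = ((b + v) - (a + u)) / ((a + u) * (b + v))"
    using assms by (simp add: field_simps)
  then show ?thesis using assms by (simp add: abs_mult abs_minus_commute)
qed

definition cf_value :: "(nat \<Rightarrow> nat) \<Rightarrow> real" where
  "cf_value a = lim (cf_conv a)"

text \<open>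
  With all digits at least 2, each step of the continued fraction contracts by a factor of at least
  4, which gives convergence by comparison with a geometric series.
\<close>

lemma cf_conv_increment:
  assumes "\<forall>i. 2 \<le> a i"
  shows "\<bar>cf_conv a (Suc n) - cf_conv a n\<bar> \<le> (1/4) ^ n"
  using assms
proof (induction n arbitrary: a)
  case 0
  have "2 \<le> real (a 0)" using spec[OF 0, of 0] by simp
  then show ?case by (simp add: field_simps)
next
  case (Suc n)
  define b where "b i = a (Suc i)" for i
  define A where "A = real (a 0)"
  have A: "2 \<le> A" using spec[OF Suc.prems, of 0] by (simp add: A_def)
  have b: "\<forall>i. 2 \<le> b i" using Suc.prems by (simp add: b_def)
  have "1 \<le> b i" for i using spec[OF b, of i] by simp
  then have u: "0 \<le> cf_conv b m" for m using cf_conv_bounds[of b m] by simp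
  have "\<bar>cf_conv a (Suc (Suc n)) - cf_conv a (Suc n)\<bar> =
      \<bar>1 / (A + cf_conv b (Suc n)) - 1 / (A + cf_conv b n)\<bar>"
    by (simp add: A_def b_def[abs_def])
  also have "\<dots> = \<bar>cf_conv b (Suc n) - cf_conv b n\<bar> / ((A + cf_conv b (Suc n)) * (A + cf_conv b n))"
    using A u[of n] u[of "Suc n"] by (subst inverse_shift_diff) (auto simp del: cf_conv.simps)
  also have "\<dots> \<le> (1/4) ^ n / (2 * 2)"
    using A u[of n] u[of "Suc n"] Suc.IH[OF b] by (intro frac_le mult_mono) (auto simp del: cf_conv.simps)
  finally show ?case by simp
qed

lemma cf_conv_tendsto_cf_value:
  assumes "\<forall>i. 2 \<le> a i"
  shows "cf_conv a \<longlonglongrightarrow> cf_value a"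
proof -
  have "summable (\<lambda>n. cf_conv a (Suc n) - cf_conv a n)"
    by (rule summable_comparison_test'[of "\<lambda>n. (1/4) ^ n" 0])
       (use cf_conv_increment[OF assms] in \<open>auto intro: summable_geometric\<close>)
  then have "convergent (\<lambda>n. (cf_conv a n - cf_conv a 0) + cf_conv a 0)"
    unfolding summable_iff_convergent sum_lessThan_telescope
    by (intro convergent_add convergent_const)
  then show ?thesis by (simp add: cf_value_def convergent_LIMSEQ_iff)
qed

lemma cf_value_step:
  assumes "\<forall>i. 2 \<le> a i"
  shows "cf_value a = 1 / (real (a 0) + cf_value (\<lambda>i. a (Suc i)))"
    and "0 < cf_value a" and "cf_value a \<le> 1/2"
proof -
  have nonneg: "0 \<le> cf_value b" if "\<forall>i. 2 \<le> b i" for b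
  proof (rule LIMSEQ_le_const[OF cf_conv_tendsto_cf_value[OF that]])
    have "1 \<le> b i" for i using spec[OF that, of i] by simp
    then have "0 \<le> cf_conv b n" for n using cf_conv_bounds[of b n] by simp
    then show "\<exists>N. \<forall>n\<ge>N. 0 \<le> cf_conv b n" by simp
  qed
  have a0: "2 \<le> real (a 0)" using spec[OF assms, of 0] by simp
  have t: "0 \<le> cf_value (\<lambda>i. a (Suc i))" by (rule nonneg) (use assms in blast)
  have "cf_conv (\<lambda>i. a (Suc i)) \<longlonglongrightarrow> cf_value (\<lambda>i. a (Suc i))"
    by (rule cf_conv_tendsto_cf_value) (use assms in blast)
  then have "(\<lambda>n. 1 / (real (a 0) + cf_conv (\<lambda>i. a (Suc i)) n)) \<longlonglongrightarrow> 1 / (real (a 0) + cf_value (\<lambda>i. a (Suc i)))"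
    using a0 t by (intro tendsto_intros) auto
  moreover have "(\<lambda>n. 1 / (real (a 0) + cf_conv (\<lambda>i. a (Suc i)) n)) \<longlonglongrightarrow> cf_value a"
    using LIMSEQ_Suc[OF cf_conv_tendsto_cf_value[OF assms]] by simp
  ultimately show eq: "cf_value a = 1 / (real (a 0) + cf_value (\<lambda>i. a (Suc i)))"
    using LIMSEQ_unique by blast
  show "0 < cf_value a" "cf_value a \<le> 1/2" unfolding eq using a0 t by (auto simp: field_simps)
qed

text \<open>
  Infinite descent:  if the value is \<open>m / n\<close>, then the value of the shifted sequence is
  \<open>(n - m * a 0) / m\<close>, a fraction with a smaller numerator because values are less than 1.
\<close>

lemma cf_value_not_fraction:
  assumes "\<forall>i. 2 \<le> a i"
  shows "cf_value a * real n \<noteq> real m \<or> n = 0"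
  using assms
proof (induction m arbitrary: a n rule: less_induct)
  case (less m)
  define b where "b i = a (Suc i)" for i
  have b: "\<forall>i. 2 \<le> b i" using less.prems by (simp add: b_def)
  define y where "y = cf_value b"
  have y: "0 < y" "y \<le> 1/2" using cf_value_step(2,3)[OF b] by (simp_all add: y_def)
  have a: "cf_value a = 1 / (real (a 0) + y)"
    using cf_value_step(1)[OF less.prems] by (simp add: y_def b_def[abs_def])
  show ?case
  proof (rule ccontr)
    assume "\<not> ?thesis"
    then have n: "0 < n" and eq: "cf_value a * real n = real m" by auto
    have "0 < real m"
      unfolding eq[symmetric] using n cf_value_step(2)[OF less.prems] by (intro mult_pos_pos) auto
    then have m: "0 < m" by simp
    have "0 < real (a 0) + y" using y by simp
    then have "real n = real m * (real (a 0) + y)"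
      using eq unfolding a by (simp add: nonzero_divide_eq_eq)
    then have nm: "real n = real m * real (a 0) + y * real m"
      by (simp add: distrib_left mult.commute)
    then have "real (m * a 0) \<le> real n" using y by simp
    then have le: "m * a 0 \<le> n" unfolding of_nat_le_iff .
    have yr: "y * real m = real (n - m * a 0)" using nm le by (simp add: of_nat_diff)
    have "y * real m < 1 * real m" using y m by (intro mult_strict_right_mono) auto
    then have "n - m * a 0 < m" unfolding yr by simp
    from less.IH[OF this b, of m] show False using yr m by (simp add: y_def)
  qed
qed

lemma cf_value_unit_irrational:
  assumes "\<forall>i. 2 \<le> a i"
  shows "cf_value a \<in> unit_irrationals"
proof -
  have pos: "0 < cf_value a" "cf_value a \<le> 1/2" using cf_value_step(2,3)[OF assms] by auto
  have "cf_value a \<notin> \<rat>"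
  proof
    assume "cf_value a \<in> \<rat>"
    then obtain m n :: nat where "n \<noteq> 0" "\<bar>cf_value a\<bar> = real m / real n"
      by (rule Rats_abs_nat_div_natE)
    then show False using cf_value_not_fraction[OF assms, of n m] pos by simp
  qed
  then show ?thesis using pos by (simp add: unit_irrationals_def)
qed

lemma cf_digit_cf_value:
  assumes "\<forall>i. 2 \<le> a i"
  shows "cf_digit (cf_value a) i = a i"
proof -
  have "1 \<le> a i" for i using spec[OF assms, of i] by simp
  then show ?thesis
    using cf_digit_unique[of "cf_value a" a i]
      cf_value_unit_irrational[OF assms] cf_conv_tendsto_cf_value[OF assms] by simp
qed

text \<open>
  Prepending a common digit \<open>k\<close> multiplies distances by at least \<open>1 / (k + 1)\<^sup>2\<close>.  At the first
  difference the denominators \<open>k + u\<close> are at least \<open>1/2\<close> apart, because the tails \<open>u\<close> lie in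
  \<open>{0..1/2}\<close> while the digits are distinct integers.
\<close>

lemma cf_value_separated:
  assumes "range x \<subseteq> {2..N}" "range y \<subseteq> {2..N}" "\<And>i. i < n \<Longrightarrow> x i = y i" "x n \<noteq> y n"
  shows "1 / (2 * (real N + 1)\<^sup>2) * (\<Prod>i<n. 1 / (real (x i) + 1)\<^sup>2) \<le> dist (cf_value x) (cf_value y)"
  using assms
proof (induction n arbitrary: x y)
  case (0 x y)
  define x' y' where "x' i = x (Suc i)" and "y' i = y (Suc i)" for i
  have x: "\<forall>i. 2 \<le> x i" "\<And>i. x i \<le> N" and y: "\<forall>i. 2 \<le> y i" "\<And>i. y i \<le> N"
    using range_subsetD[OF 0(1)] range_subsetD[OF 0(2)] by simp_all
  define u v where "u = cf_value x'" and "v = cf_value y'"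
  have u: "0 < u" "u \<le> 1/2" and v: "0 < v" "v \<le> 1/2"
    using cf_value_step(2,3)[of x'] cf_value_step(2,3)[of y'] x y by (simp_all add: u_def v_def x'_def y'_def)
  have "dist (cf_value x) (cf_value y) = \<bar>1 / (real (x 0) + u) - 1 / (real (y 0) + v)\<bar>"
    using cf_value_step(1)[OF x(1)] cf_value_step(1)[OF y(1)]
    by (simp add: u_def v_def x'_def[abs_def] y'_def[abs_def] dist_real_def)
  also have "\<dots> = \<bar>(real (x 0) + u) - (real (y 0) + v)\<bar> / ((real (x 0) + u) * (real (y 0) + v))"
    using u v by (intro inverse_shift_diff) auto
  also have "\<dots> \<ge> (1/2) / ((real N + 1) * (real N + 1))"
  proof (rule frac_le)
    have "1 \<le> \<bar>real (x 0) - real (y 0)\<bar>" using 0(4) by linarith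
    then show "1/2 \<le> \<bar>(real (x 0) + u) - (real (y 0) + v)\<bar>" using u v by linarith
    show "(real (x 0) + u) * (real (y 0) + v) \<le> (real N + 1) * (real N + 1)"
      using x(2)[of 0] y(2)[of 0] u v by (intro mult_mono) auto
    show "0 < (real (x 0) + u) * (real (y 0) + v)" using u v by (intro mult_pos_pos) auto
  qed simp
  finally show ?case by (simp add: power2_eq_square)
next
  case (Suc n x y)
  define x' y' where "x' i = x (Suc i)" and "y' i = y (Suc i)" for i
  have x: "\<forall>i. 2 \<le> x i" and y: "\<forall>i. 2 \<le> y i"
    using range_subsetD[OF Suc.prems(1)] range_subsetD[OF Suc.prems(2)] by simp_all
  define u v where "u = cf_value x'" and "v = cf_value y'"
  have u: "0 < u" "u \<le> 1/2" and v: "0 < v" "v \<le> 1/2"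
    using cf_value_step(2,3)[of x'] cf_value_step(2,3)[of y'] x y by (simp_all add: u_def v_def x'_def y'_def)
  have xy0: "y 0 = x 0" using Suc.prems(3)[of 0] by simp
  define c where "c = real (x 0)"
  define p where "p = 1 / (2 * (real N + 1)\<^sup>2) * (\<Prod>i<n. 1 / (real (x' i) + 1)\<^sup>2)"
  have IH: "p \<le> \<bar>u - v\<bar>"
    unfolding p_def u_def v_def dist_real_def[symmetric]
    by (rule Suc.IH) (use Suc.prems in \<open>auto simp: x'_def y'_def\<close>)
  have "1 / (2 * (real N + 1)\<^sup>2) * (\<Prod>i<Suc n. 1 / (real (x i) + 1)\<^sup>2) = p / (c + 1)\<^sup>2"
    by (simp add: prod.lessThan_Suc_shift p_def c_def x'_def
        del: prod.lessThan_Suc)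
  also have "\<dots> \<le> \<bar>u - v\<bar> / ((c + u) * (c + v))"
    unfolding power2_eq_square
    using IH u v by (intro frac_le mult_mono mult_pos_pos) (auto simp: c_def)
  also have "\<dots> = \<bar>1 / (c + u) - 1 / (c + v)\<bar>"
    using u v by (subst inverse_shift_diff) (auto simp: c_def)
  also have "\<dots> = dist (cf_value x) (cf_value y)"
    using cf_value_step(1)[OF x] cf_value_step(1)[OF y]
    by (simp add: u_def v_def x'_def[abs_def] y'_def[abs_def] dist_real_def c_def xy0)
  finally show ?case .
qed

section \<open>Dimension bounds for digits bounded below\<close>

text \<open>
  The middle term is the integral of \<open>t powr (-1 - e)\<close> over \<open>{x..x + 1}\<close>.
\<close>

lemma powr_telescope_bounds:
  fixes x e :: real
  assumes "0 < x" "0 < e"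
  shows "(x + 1) powr (-1 - e) \<le> (x powr (-e) - (x + 1) powr (-e)) / e"
    and "(x powr (-e) - (x + 1) powr (-e)) / e \<le> x powr (-1 - e)"
proof -
  have "\<exists>z. x < z \<and> z < x + 1 \<and>
      (x + 1) powr (-e) - x powr (-e) = (x + 1 - x) * (-e * z powr (-e - 1))"
    using assms by (intro MVT2 has_real_derivative_powr) auto
  then obtain z where z: "x < z" "z < x + 1"
    "(x + 1) powr (-e) - x powr (-e) = (x + 1 - x) * (-e * z powr (-e - 1))"
    by blast
  then have eq: "(x powr (-e) - (x + 1) powr (-e)) / e = z powr (-1 - e)"
    using assms unfolding minus_diff_commute[of e 1] by (simp add: field_simps)
  show "(x + 1) powr (-1 - e) \<le> (x powr (-e) - (x + 1) powr (-e)) / e"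
    "(x powr (-e) - (x + 1) powr (-e)) / e \<le> x powr (-1 - e)"
    unfolding eq using z assms by (auto intro!: powr_mono2')
qed

lemma inverse_square_powr: "0 < x \<Longrightarrow> (1 / x\<^sup>2) powr (1/2 + e/2) = x powr (-1 - e)" for x :: real
proof -
  assume x: "0 < x"
  have "1 / x\<^sup>2 = x powr (-2)" using x by (simp add: powr_minus inverse_eq_divide)
  then show ?thesis using x by (simp add: powr_powr algebra_simps)
qed

lemma sum_powr_telescope:
  "(\<Sum>k<n. ((Q + real k) powr a - (Q + real (Suc k)) powr a) / e) = (Q powr a - (Q + real n) powr a) / e"
  using sum_lessThan_telescope'[of "\<lambda>k. (Q + real k) powr a" n]
  by (simp add: sum_divide_distrib[symmetric] del: of_nat_Suc)

lemma hausdorff_dim_cf_digits_ge_upper: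
  assumes q: "2 \<le> q" and e: "0 < e" "(real q - 1) powr (-e) < e"
  shows "hausdorff_dim (cf_digits_ge q) \<le> ereal (1/2 + e/2)"
proof (rule hausdorff_dim_le)
  define A where "A = cf_digits_ge q"
  define L where "L k = 1 / (real q + real k)\<^sup>2" for k
  define f where "f k x = 1 / (real (q + k) + x)" for k and x :: real
  have A01: "0 < x" "x < 1" if "x \<in> A" for x
    using that by (auto simp: A_def cf_digits_ge_def unit_irrationals_def)
  have "hausdorff_measure (1/2 + e/2) A = 0"
  proof (rule hausdorff_measure_zero_if_contracting[of A f L "1/4"])
    show "bounded A" by (rule bounded_subset[of "{0..1}"]) (use A01 in \<open>auto simp: less_imp_le\<close>)
    show "A \<subseteq> (\<Union>k. f k ` A)"
    proof
      fix x assume x: "x \<in> A"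
      then have xi: "x \<in> unit_irrationals" and d: "\<And>i. q \<le> cf_digit x i"
        by (auto simp: A_def cf_digits_ge_def)
      have "gauss_map x \<in> A"
        using gauss_map_unit_irrationals[OF xi] d
        by (simp add: A_def cf_digits_ge_def cf_digit_Suc[symmetric])
      moreover have "x = f (cf_digit x 0 - q) (gauss_map x)"
        using gauss_map_step[OF xi] d[of 0] by (simp add: f_def)
      ultimately show "x \<in> (\<Union>k. f k ` A)" by blast
    qed
    show "dist (f k x) (f k y) \<le> L k * dist x y" if "x \<in> A" "y \<in> A" for k x y
    proof -
      have "dist (f k x) (f k y) = \<bar>x - y\<bar> / ((real (q + k) + x) * (real (q + k) + y))"
        using A01[OF that(1)] A01[OF that(2)] unfolding f_def dist_real_def
        by (subst inverse_shift_diff) auto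
      also have "\<dots> \<le> \<bar>x - y\<bar> / (real (q + k) * real (q + k))"
        using A01[OF that(1)] A01[OF that(2)] q by (intro divide_left_mono mult_mono mult_pos_pos) auto
      finally show ?thesis by (simp add: L_def dist_real_def power2_eq_square)
    qed
    show "0 \<le> L k" for k by (simp add: L_def)
    show "L k \<le> 1/4" for k
    proof -
      have "2\<^sup>2 \<le> (real q + real k)\<^sup>2" using q by (intro power_mono) auto
      then show ?thesis unfolding L_def by (intro divide_left_mono) auto
    qed
    define Q where "Q = real q - 1"
    have Q: "1 \<le> Q" using q by (simp add: Q_def)
    have "(\<Sum>k. ennreal (L k powr (1/2 + e/2))) \<le> ennreal (Q powr (-e) / e)"
    proof (intro suminf_le_const summableI)
      fix n
      have "(\<Sum>k<n. L k powr (1/2 + e/2)) \<le> (\<Sum>k<n. ((Q + real k) powr (-e) - (Q + real (Suc k)) powr (-e)) / e)"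
      proof (rule sum_mono)
        fix k
        have "L k powr (1/2 + e/2) = (Q + real k + 1) powr (-1 - e)"
          using inverse_square_powr[of "Q + real k + 1" e] Q by (simp add: L_def Q_def)
        also have "\<dots> \<le> ((Q + real k) powr (-e) - (Q + real k + 1) powr (-e)) / e"
          using Q e by (intro powr_telescope_bounds) auto
        finally show "L k powr (1/2 + e/2) \<le> ((Q + real k) powr (-e) - (Q + real (Suc k)) powr (-e)) / e"
          by (simp add: algebra_simps)
      qed
      also have "\<dots> = (Q powr (-e) - (Q + real n) powr (-e)) / e"
        by (rule sum_powr_telescope)
      also have "\<dots> \<le> Q powr (-e) / e" using e by (intro divide_right_mono) auto
      finally show "(\<Sum>k<n. ennreal (L k powr (1/2 + e/2))) \<le> ennreal (Q powr (-e) / e)"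
        by (simp add: sum_ennreal ennreal_leI)
    qed
    also have "\<dots> < 1" using e by (simp add: Q_def ennreal_less_one_iff)
    finally show "(\<Sum>k. ennreal (L k powr (1/2 + e/2))) < 1" .
  qed (use e in auto)
  then show "hausdorff_measure (1/2 + e/2) (cf_digits_ge q) = 0" by (simp add: A_def)
qed (use e in simp)

lemma hausdorff_dim_cf_digits_ge_lower:
  assumes q: "2 \<le> q" and e: "0 < e" "e < (real q + 1) powr (-e)"
  shows "ereal (1/2 + e/2) \<le> hausdorff_dim (cf_digits_ge q)"
proof -
  define Q where "Q = real q + 1"
  have "(\<lambda>n. (Q powr (-e) - (Q + real n) powr (-e)) / e) \<longlonglongrightarrow> (Q powr (-e) - 0) / e"
    by (intro tendsto_intros tendsto_neg_powr filterlim_tendsto_add_at_top[OF tendsto_const]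
        filterlim_real_sequentially) (use e in auto)
  moreover have "1 < (Q powr (-e) - 0) / e" using e by (simp add: Q_def)
  ultimately have "\<forall>\<^sub>F n in sequentially. 1 < (Q powr (-e) - (Q + real n) powr (-e)) / e"
    by (rule order_tendstoD(1))
  then obtain n where n: "1 < (Q powr (-e) - (Q + real n) powr (-e)) / e"
    by (auto simp: eventually_sequentially)
  define r where "r a = 1 / (real a + 1)\<^sup>2" for a
  define D where "D = {q..<q + n}"
  have "1 \<le> (\<Sum>k<n. ((Q + real k) powr (-e) - (Q + real (Suc k)) powr (-e)) / e)"
    using n unfolding sum_powr_telescope by simp
  also have "\<dots> \<le> (\<Sum>k<n. r (q + k) powr (1/2 + e/2))"
  proof (rule sum_mono)
    fix k
    have "((Q + real k) powr (-e) - (Q + real k + 1) powr (-e)) / e \<le> (Q + real k) powr (-1 - e)"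
      using e by (intro powr_telescope_bounds) (auto simp: Q_def)
    also have "\<dots> = r (q + k) powr (1/2 + e/2)"
      using inverse_square_powr[of "Q + real k" e] by (simp add: r_def Q_def algebra_simps)
    finally show "((Q + real k) powr (-e) - (Q + real (Suc k)) powr (-e)) / e \<le> r (q + k) powr (1/2 + e/2)"
      by (simp add: algebra_simps)
  qed
  also have "\<dots> = (\<Sum>a\<in>D. r a powr (1/2 + e/2))"
    unfolding D_def by (rule sum.reindex_bij_witness[of _ "\<lambda>a. a - q" "\<lambda>k. q + k"]) auto
  finally have sum: "1 \<le> (\<Sum>a\<in>D. r a powr (1/2 + e/2))" .
  have D2: "D \<subseteq> {2..q + n}" using q by (auto simp: D_def)
  show ?thesis
  proof (rule hausdorff_dim_ge_separated_coding[of D "1/2 + e/2" "1 / (2 * (real (q + n) + 1)\<^sup>2)" r cf_value])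
    show "0 < 1 / (2 * (real (q + n) + 1)\<^sup>2)" by simp
    show "r a < 1" if "a \<in> D" for a
      using that q by (auto simp: r_def D_def intro!: one_less_power)
    show "1 / (2 * (real (q + n) + 1)\<^sup>2) * (\<Prod>i<m. r (x i)) \<le> dist (cf_value x) (cf_value y)"
      if "range x \<subseteq> D" "range y \<subseteq> D" "\<And>i. i < m \<Longrightarrow> x i = y i" "x m \<noteq> y m" for x y m
      unfolding r_def by (rule cf_value_separated) (use that D2 in blast)+
    show "cf_value x \<in> cf_digits_ge q" if "range x \<subseteq> D" for x
    proof -
      have "q \<le> x i" for i using range_subsetD[OF that, of i] by (simp add: D_def)
      moreover have "2 \<le> x i" for i using order_trans[OF q] calculation .
      ultimately show ?thesis by (simp add: cf_digits_ge_def cf_value_unit_irrational cf_digit_cf_value)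
    qed
  qed (use e sum in \<open>auto simp: D_def r_def\<close>)
qed

theorem proposition1p9:
  shows "(\<lambda>q::nat. real_of_ereal (hausdorff_dim (cf_digits_ge q)) - 1 / 2)
           \<sim>[at_top] (\<lambda>q. 1 / 2 * (ln (ln (real q)) / ln (real q)))"
proof (rule asymp_equiv_sandwich_real)
  \<comment> \<open>\<open>?u\<close> makes \<open>(q - 1) powr (- ?u) = 1 / ln (q - 1)\<close>.  For \<open>?l\<close>, with \<open>l = ln (ln (q + 1))\<close>,
    one has \<open>(q + 1) powr (- ?l) = l / ln (q + 1)\<close>; subtracting \<open>ln l\<close> is what brings \<open>?l\<close> below
    this value.\<close>
  let ?u = "\<lambda>q::nat. ln (ln (real q - 1)) / ln (real q - 1)"
  let ?l = "\<lambda>q::nat. (ln (ln (real q + 1)) - ln (ln (ln (real q + 1)))) / ln (real q + 1)"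
  show "(\<lambda>q. ?l q / 2) \<sim>[at_top] (\<lambda>q. 1 / 2 * (ln (ln (real q)) / ln (real q)))"
    by real_asymp
  show "(\<lambda>q. ?u q / 2) \<sim>[at_top] (\<lambda>q. 1 / 2 * (ln (ln (real q)) / ln (real q)))"
    by real_asymp
  have "\<forall>\<^sub>F q in at_top. 0 < ?u q" "\<forall>\<^sub>F q in at_top. (real q - 1) powr (- ?u q) < ?u q"
    "\<forall>\<^sub>F q in at_top. 0 < ?l q" "\<forall>\<^sub>F q in at_top. ?l q < (real q + 1) powr (- ?l q)"
    by real_asymp+
  then show "\<forall>\<^sub>F q in at_top. real_of_ereal (hausdorff_dim (cf_digits_ge q)) - 1 / 2 \<in> {?l q / 2..?u q / 2}"
    using eventually_ge_at_top[of 2]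
  proof eventually_elim
    case (elim q)
    have "ereal (1/2 + ?l q / 2) \<le> hausdorff_dim (cf_digits_ge q)"
      "hausdorff_dim (cf_digits_ge q) \<le> ereal (1/2 + ?u q / 2)"
      by (blast intro: hausdorff_dim_cf_digits_ge_lower hausdorff_dim_cf_digits_ge_upper elim)+
    then show ?case by (cases "hausdorff_dim (cf_digits_ge q)") auto
  qed
qed

end
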